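(* Consider the problem of minimizing $f=\sum_{i=1}^m f_i$ over $X$, and suppose that Assumption 1 (common optimal solution) and Assumption 2 (Hölder condition of order $p>0$ with moduli $L_i$) stated in the context hold. Let $\{x_k\}$ be a sequence generated by the randomized incremental subgradient method described in the context with the dynamic stepsize rule $$v_k=\gamma_k\frac{R_{p,m}}{m}\left(f(x_k)-f^*\right)^{\frac1p}\quad\text{for any }k\in\mathbb{N},$$ where $0<\underline{\gamma}\le\gamma_k\le\overline{\gamma}<2$ and $R_{p,m}:=L_{\max}^{-\frac1p}\min\{1,m^{1-\frac1p}\}$. Then $\{x_k\}$ converges to an optimal solution of the problem, i.e. to a point of $X^*$, with probability 1.
   Context: Setting. $X\subseteq\mathbb{R}^n$ is nonempty, closed and convex, and $f_1,\dots,f_m:\mathbb{R}^n\to\mathbb{R}$ are continuous and quasi-convex (a function $h$ is quasi-convex if $h((1-\alpha)x+\alpha y)\le\max\{h(x),h(y)\}$ for all $x,y\in\mathbb{R}^n$, $\alpha\in[0,1]$). Put $f:=\sum_{i=1}^m f_i$ ($f$ need not be quasi-convex), $f^*:=\min_{x\in X}f(x)$, $X^*:=\arg\min_{x\in X}f(x)$, $f_i^*:=\min_{x\in X}f_i(x)$, $X_i^*:=\arg\min_{x\in X}f_i(x)$. $\mathbb{N}=\{0,1,2,\dots\}$; $\|\cdot\|$ is the Euclidean norm, $P_X$ the Euclidean projection onto $X$, and $S(0,1)$ the unit sphere. $\underline\gamma,\overline\gamma$ are constants. Assumption 1. The component functions have a common optimal solution over $X$ (equivalently $X^*=\bigcap_{i=1}^m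 X_i^*\neq\emptyset$). Assumption 2. $p>0$, $L_i>0$ for $i=1,\dots,m$, and for each $i$, $|f_i(y)-f_i(x)|\le L_i\|y-x\|^p$ for all $x\in X$ and all $y\in\mathbb{R}^n$. Put $L_{\max}:=\max_{i=1,\dots,m}L_i$. Quasi-subdifferential. For quasi-convex $h:\mathbb{R}^n\to\mathbb{R}$ and $x\in\mathbb{R}^n$, $\partial h(x):=\{g:\langle g,y-x\rangle\le 0\text{ for every } y \text{ with } h(y)<h(x)\}$. Randomized incremental subgradient method. Initialize an initial point $x_0\in\mathbb{R}^n$, a stepsize sequence $\{v_k\}$, and $k:=0$. While $f(x_k)>f^*$: let $I_k:=\{i\in\{1,\dots,m\}:f_i(x_k)>f_i^*\}$; pick equiprobably a random variable $\omega_k$ from the set $I_k$, calculate $g_{k,\omega_k}\in\partial f_{\omega_k}(x_k)\cap S(0,1)$, and set $x_{k+1}:=P_X(x_k-v_kg_{k,\omega_k})$; then $k:=k+1$.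
   Formalization: The initial point is assumed to satisfy x_0 in X or f(x_0) > f*; otherwise the loop stops at once at an infeasible, non-optimal point (e.g. X=[0,∞), m=1, f(x)=x, x_0=-1), and the claim fails. *)

theory Defs
  imports "HOL-Probability.Probability"
begin

definition quasi_convex :: "('a::real_vector \<Rightarrow> real) \<Rightarrow> bool" where
  "quasi_convex h \<longleftrightarrow>
     (\<forall>x y. \<forall>\<alpha>\<in>{0..1}. h ((1 - \<alpha>) *\<^sub>R x + \<alpha> *\<^sub>R y) \<le> max (h x) (h y))"

definition quasi_subdiff :: "('a::real_inner \<Rightarrow> real) \<Rightarrow> 'a \<Rightarrow> 'a set" where
  "quasi_subdiff h x = {g. \<forall>y. h y < h x \<longrightarrow> inner g (y - x) \<le> 0}"

definition optimal_set :: "'a set \<Rightarrow> ('a \<Rightarrow> real) \<Rightarrow> 'a set" where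
  "optimal_set X h = {x. is_arg_min h (\<lambda>x. x \<in> X) x}"

text \<open>The infimum is the minimum whenever \<open>optimal_set X h\<close> is nonempty; for all the
  functions below this is ensured by the existence of a common optimal solution.\<close>

definition optimal_value :: "'a set \<Rightarrow> ('a \<Rightarrow> real) \<Rightarrow> real" where
  "optimal_value X h = (INF x\<in>X. h x)"

definition objective :: "nat \<Rightarrow> (nat \<Rightarrow> 'a \<Rightarrow> real) \<Rightarrow> 'a \<Rightarrow> real" where
  "objective m f x = (\<Sum>i = 1..m. f i x)"

definition common_optimal :: "'a set \<Rightarrow> nat \<Rightarrow> (nat \<Rightarrow> 'a \<Rightarrow> real) \<Rightarrow> bool" where
  "common_optimal X m f \<longleftrightarrow> (\<Inter>i\<in>{1..m}. optimal_set X (f i)) \<noteq> {}"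

definition holder_condition ::
    "'a::real_normed_vector set \<Rightarrow> real \<Rightarrow> real \<Rightarrow> ('a \<Rightarrow> real) \<Rightarrow> bool" where
  "holder_condition X p L h \<longleftrightarrow>
     (\<forall>x\<in>X. \<forall>y. \<bar>h y - h x\<bar> \<le> L * norm (y - x) powr p)"

definition R_const :: "real \<Rightarrow> nat \<Rightarrow> (nat \<Rightarrow> real) \<Rightarrow> real" where
  "R_const p m L = Max (L ` {1..m}) powr (- 1 / p) * min 1 (real m powr (1 - 1 / p))"

definition active_set :: "'a set \<Rightarrow> nat \<Rightarrow> (nat \<Rightarrow> 'a \<Rightarrow> real) \<Rightarrow> 'a \<Rightarrow> nat set" where
  "active_set X m f x = {i \<in> {1..m}. f i x > optimal_value X (f i)}"

text \<open>The sigma-algebra on the sample space generated by the iterates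
  \<open>x 0, \<dots>, x k\<close>.\<close>

definition history ::
    "'w measure \<Rightarrow> (nat \<Rightarrow> 'w \<Rightarrow> 'a::topological_space) \<Rightarrow> nat \<Rightarrow> 'w measure" where
  "history M x k =
     vimage_algebra (space M) (\<lambda>\<omega>. \<lambda>j\<in>{..k}. x j \<omega>) (PiM {..k} (\<lambda>_. borel))"

text \<open>The processes \<open>x\<close>, \<open>idx\<close>, \<open>g\<close>, \<open>v\<close> on the sample space of \<open>M\<close> are the
  iterates, the selected indices, the selected unit quasi-subgradients and the stepsizes of a
  run from \<open>x0\<close>. A run that leaves the while loop at step \<open>k\<close> is continued by the
  constant value \<open>x k\<close>, and \<open>idx\<close>, \<open>g\<close>, \<open>v\<close> are irrelevant from then on.
  The last conjunct says that, while the loop is running, the conditional law of \<open>idx k\<close> given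
  the past is uniform on the active set at \<open>x k\<close>. Conditioning on the iterates only is the
  weakest such requirement: it follows, by the tower property, from uniformity conditionally on
  any larger past (including earlier indices and subgradients). The subgradient may be
  chosen in any way, possibly depending on the index and on the past, as long as
  the iterates are random variables.\<close>

definition incremental_subgradient_run ::
    "'a::euclidean_space set \<Rightarrow> nat \<Rightarrow> (nat \<Rightarrow> 'a \<Rightarrow> real) \<Rightarrow> 'w measure \<Rightarrow> 'a \<Rightarrow>
     (nat \<Rightarrow> 'w \<Rightarrow> real) \<Rightarrow> (nat \<Rightarrow> 'w \<Rightarrow> 'a) \<Rightarrow> (nat \<Rightarrow> 'w \<Rightarrow> nat) \<Rightarrow> (nat \<Rightarrow> 'w \<Rightarrow> 'a) \<Rightarrow> bool"
  where
  "incremental_subgradient_run X m f M x0 v x idx g \<longleftrightarrow>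
     (\<forall>k. x k \<in> borel_measurable M) \<and>
     (\<forall>k. idx k \<in> measurable M (count_space UNIV)) \<and>
     (\<forall>\<omega>\<in>space M. x 0 \<omega> = x0) \<and>
     (\<forall>k. \<forall>\<omega>\<in>space M.
        if objective m f (x k \<omega>) > optimal_value X (objective m f)
        then idx k \<omega> \<in> active_set X m f (x k \<omega>) \<and>
             g k \<omega> \<in> quasi_subdiff (f (idx k \<omega>)) (x k \<omega>) \<inter> sphere 0 1 \<and>
             x (Suc k) \<omega> = closest_point X (x k \<omega> - v k \<omega> *\<^sub>R g k \<omega>)
        else x (Suc k) \<omega> = x k \<omega>) \<and>
     (\<forall>k. \<forall>i\<in>{1..m}. AE \<omega> in M.
        objective m f (x k \<omega>) > optimal_value X (objective m f) \<longrightarrow>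
        real_cond_exp M (history M x k) (indicator {\<omega>' \<in> space M. idx k \<omega>' = i}) \<omega> =
          indicator (active_set X m f (x k \<omega>)) i / real (card (active_set X m f (x k \<omega>))))"

end

theory Submission
  imports Defs
begin

text \<open>Let \<open>z\<close> be a common minimiser. If \<open>f i\<close> exceeds its minimum at \<open>x k\<close>, then by the Hoelder
  condition a whole ball around \<open>z\<close> consists of points with smaller values of \<open>f i\<close>, and every
  unit quasi-subgradient \<open>g\<close> of \<open>f i\<close> at \<open>x k\<close> separates \<open>x k\<close> from that ball. Hence
  \<open>\<langle>g, x k - z\<rangle>\<close> is at least the radius of the ball, a power of the gap of \<open>f i\<close>
  (\<open>quasi_subgradient_inner_ge\<close>), and since projections do not increase distances, a step of
  length \<open>v k\<close> changes the squared distance to \<open>z\<close> by at most \<open>(v k)\<^sup>2 - 2 v k \<langle>g, x k - z\<rangle>\<close>.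

  The constant in the stepsize is such that \<open>v k / \<gamma> k\<close> is at most the average of these radii
  over the active indices (\<open>base_step_le_mean_radius\<close>), a consequence of the subadditivity or
  convexity of the power function. Averaging over the drawn index therefore gives
  \<open>E \<parallel>x (k+1) - z\<parallel>\<^sup>2 \<le> E \<parallel>x k - z\<parallel>\<^sup>2 - (2 / \<gamma>_hi - 1) E (v k)\<^sup>2\<close>
  (\<open>expected_decrease\<close>), with a positive factor because \<open>\<gamma>_hi < 2\<close>. The sum of all \<open>E (v k)\<^sup>2\<close> is
  thus finite, and almost surely \<open>(v k)\<^sup>2\<close> is summable.

  The rest is deterministic. The inner products above are nonnegative on every path, not only on
  average, so on a path with summable \<open>(v k)\<^sup>2\<close> the squared distance to every minimiser decreases
  up to a summable error (\<open>quasi_fejer_convergent\<close>). Moreover \<open>v k\<close> tends to zero, which forces the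
  objective to its minimum because \<open>\<gamma> k\<close> stays above \<open>\<gamma>_lo > 0\<close>; so all cluster points are
  minimisers, and the path converges to one of them.\<close>

section \<open>Common minimisers\<close>

lemma optimal_setD:
  assumes "z \<in> optimal_set X h"
  shows "z \<in> X" and "\<And>y. y \<in> X \<Longrightarrow> h z \<le> h y"
  using assms by (auto simp: optimal_set_def is_arg_min_def not_less)

lemma optimal_setI:
  assumes "z \<in> X" and "\<And>y. y \<in> X \<Longrightarrow> h z \<le> h y"
  shows "z \<in> optimal_set X h"
  using assms by (auto simp: optimal_set_def is_arg_min_def not_less)

lemma optimal_value_eq:
  assumes "z \<in> optimal_set X h"
  shows "optimal_value X h = h z"
  unfolding optimal_value_def
  using optimal_setD[OF assms] by (intro cInf_eq_minimum) auto

lemma objective_common_minimiser: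
  assumes "z \<in> (\<Inter>i\<in>{1..m}. optimal_set X (f i))" and "m \<ge> 1"
  shows "z \<in> optimal_set X (objective m f)"
proof (rule optimal_setI)
  show "z \<in> X"
    using assms optimal_setD(1)[of z X "f 1"] by auto
  fix y assume "y \<in> X"
  then have "f i z \<le> f i y" if "i \<in> {1..m}" for i
    using assms(1) that by (intro optimal_setD(2)) auto
  then show "objective m f z \<le> objective m f y"
    unfolding objective_def by (rule sum_mono)
qed

text \<open>If the sum attains the sum of the minima, no summand can exceed its own minimum, so
  every minimiser of the sum minimises each summand.\<close>

lemma optimal_set_objective:
  assumes "common_optimal X m f" and "m \<ge> 1"
  shows "optimal_set X (objective m f) = (\<Inter>i\<in>{1..m}. optimal_set X (f i))"
proof (intro equalityI subsetI)
  fix y assume y: "y \<in> optimal_set X (objective m f)"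
  obtain z where z: "z \<in> (\<Inter>i\<in>{1..m}. optimal_set X (f i))"
    using assms(1) by (auto simp: common_optimal_def)
  have yX: "y \<in> X" and zX: "z \<in> X"
    by (rule optimal_setD(1)[OF y], rule optimal_setD(1)[OF objective_common_minimiser[OF z assms(2)]])
  have le: "f i z \<le> f i y" if "i \<in> {1..m}" for i
    using z that yX by (intro optimal_setD(2)) auto
  have "objective m f y \<le> objective m f z"
    using optimal_setD(2)[OF y zX] .
  then have "(\<Sum>i=1..m. f i y - f i z) \<le> 0"
    by (simp add: objective_def sum_subtractf)
  moreover have "(\<Sum>i=1..m. f i y - f i z) \<ge> 0"
    using le by (intro sum_nonneg) auto
  ultimately have "(\<Sum>i=1..m. f i y - f i z) = 0"
    by linarith
  then have eq: "f i y = f i z" if "i \<in> {1..m}" for i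
    using le that by (subst (asm) sum_nonneg_eq_0_iff) auto
  show "y \<in> (\<Inter>i\<in>{1..m}. optimal_set X (f i))"
  proof
    fix i assume i: "i \<in> {1..m}"
    then have "z \<in> optimal_set X (f i)"
      using z by auto
    then show "y \<in> optimal_set X (f i)"
      using yX eq[OF i] by (simp add: optimal_set_def is_arg_min_def)
  qed
qed (rule objective_common_minimiser[OF _ assms(2)])

lemma optimal_value_objective:
  assumes "common_optimal X m f" and "m \<ge> 1"
  shows "optimal_value X (objective m f) = (\<Sum>i=1..m. optimal_value X (f i))"
proof -
  obtain z where z: "z \<in> (\<Inter>i\<in>{1..m}. optimal_set X (f i))"
    using assms(1) by (auto simp: common_optimal_def)
  then have "optimal_value X (objective m f) = objective m f z"
    using objective_common_minimiser[OF z assms(2)] by (rule_tac optimal_value_eq)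
  also have "\<dots> = (\<Sum>i=1..m. optimal_value X (f i))"
    unfolding objective_def using z by (intro sum.cong refl) (metis INT_E optimal_value_eq)
  finally show ?thesis .
qed

section \<open>Deterministic estimates for one projected step\<close>

text \<open>By the Hoelder condition, the open ball around \<open>z\<close> whose radius is the left-hand side
  lies in the strict sublevel set of \<open>h\<close> at \<open>y\<close>. The half-space cut out by \<open>g\<close> through \<open>y\<close>
  contains that set, so the distance of \<open>z\<close> from its boundary is at least the radius.\<close>

lemma quasi_subgradient_inner_ge:
  fixes X :: "'a::real_inner set"
  assumes holder: "holder_condition X p L h" and "L > 0" and "p > 0"
    and "z \<in> X" and less: "h z < h y"
    and g: "g \<in> quasi_subdiff h y" "norm g = 1"
  shows "((h y - h z) / L) powr (1 / p) \<le> inner g (y - z)" (is "?r \<le> _")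
proof (rule dense_le_bounded)
  show "0 < ?r"
    using assms by simp
  fix s assume s: "0 < s" "s < ?r"
  have "\<bar>h (z + s *\<^sub>R g) - h z\<bar> \<le> L * norm (z + s *\<^sub>R g - z) powr p"
    using holder \<open>z \<in> X\<close> unfolding holder_condition_def by blast
  also have "\<dots> = L * s powr p"
    using g s by simp
  also have "\<dots> < L * ?r powr p"
    using s \<open>L > 0\<close> \<open>p > 0\<close> by (intro mult_strict_left_mono powr_less_mono2) auto
  also have "?r powr p = (h y - h z) / L"
    using assms by (simp add: powr_powr)
  finally have "h (z + s *\<^sub>R g) < h y"
    using \<open>L > 0\<close> by simp
  then have "inner g (z + s *\<^sub>R g - y) \<le> 0"
    using g by (simp add: quasi_subdiff_def)
  moreover have "inner g g = 1"
    using g by (simp add: dot_square_norm)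
  ultimately show "s \<le> inner g (y - z)"
    by (simp add: inner_diff_right inner_add_right)
qed

lemma projected_step_dist:
  fixes X :: "'a::euclidean_space set"
  assumes "closed X" "convex X" "z \<in> X" "norm g = 1"
  shows "(norm (closest_point X (y - v *\<^sub>R g) - z))\<^sup>2 \<le> (norm (y - z))\<^sup>2 - 2 * v * inner g (y - z) + v\<^sup>2"
proof -
  have "dist (closest_point X (y - v *\<^sub>R g)) (closest_point X z) \<le> dist (y - v *\<^sub>R g) z"
    using assms by (intro closest_point_lipschitz) auto
  then have "norm (closest_point X (y - v *\<^sub>R g) - z) \<le> norm ((y - z) - v *\<^sub>R g)"
    using closest_point_self[OF \<open>z \<in> X\<close>] by (simp add: dist_norm algebra_simps)
  then have "(norm (closest_point X (y - v *\<^sub>R g) - z))\<^sup>2 \<le> (norm ((y - z) - v *\<^sub>R g))\<^sup>2"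
    by (rule power_mono) simp
  also have "\<dots> = (norm (y - z))\<^sup>2 - 2 * v * inner g (y - z) + v\<^sup>2 * inner g g"
    unfolding power2_norm_eq_inner
    by (simp add: inner_diff_left inner_diff_right inner_commute algebra_simps power2_eq_square)
  also have "inner g g = 1"
    using assms by (simp add: dot_square_norm)
  finally show ?thesis
    by simp
qed

text \<open>This is where the factor \<open>min {1, m\<^bsup>1 - q\<^esup>}\<close> in the stepsize comes from, with
  \<open>q = 1 / p\<close>: the power \<open>q\<close> is subadditive if \<open>q \<le> 1\<close>; if \<open>q \<ge> 1\<close> it is convex, and Jensen's
  inequality costs the factor \<open>m\<^bsup>1 - q\<^esup>\<close>.\<close>

lemma sum_powr_ge:
  fixes a :: "'i \<Rightarrow> real"
  assumes "finite J" and pos: "\<And>i. i \<in> J \<Longrightarrow> a i > 0" and "card J \<le> m" and "q > 0"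
  shows "min 1 (real m powr (1 - q)) * (\<Sum>i\<in>J. a i) powr q \<le> (\<Sum>i\<in>J. a i powr q)"
proof (cases "J = {}")
  case False
  define s where "s = (\<Sum>i\<in>J. a i)"
  have s: "s > 0"
    unfolding s_def using assms False by (intro sum_pos) auto
  have n: "card J > 0"
    using False assms by (simp add: card_gt_0_iff)
  show ?thesis
  proof (cases "q \<le> 1")
    case True
    have "1 = (\<Sum>i\<in>J. a i / s)"
      using s by (simp add: s_def flip: sum_divide_distrib)
    also have "\<dots> \<le> (\<Sum>i\<in>J. (a i / s) powr q)"
    proof (intro sum_mono)
      fix i assume i: "i \<in> J"
      have "a i \<le> s"
        unfolding s_def using assms i by (intro member_le_sum) (auto intro: less_imp_le)
      then have "a i / s \<in> {0<..1}"
        using pos[OF i] s by simp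
      moreover from this have "(a i / s) powr 1 \<le> (a i / s) powr q"
        using True by (intro powr_mono') auto
      ultimately show "a i / s \<le> (a i / s) powr q"
        by (simp only: powr_one greaterThanAtMost_iff less_imp_le)
    qed
    also have "\<dots> = (\<Sum>i\<in>J. a i powr q) / s powr q"
      using pos s by (simp add: powr_divide less_imp_le sum_divide_distrib)
    finally have "s powr q \<le> (\<Sum>i\<in>J. a i powr q)"
      using s by (simp add: field_simps)
    moreover have "min 1 (real m powr (1 - q)) * s powr q \<le> 1 * s powr q"
      by (intro mult_right_mono) auto
    ultimately show ?thesis
      by (simp add: s_def)
  next
    case False
    have "(\<Sum>i\<in>J. (1 / real (card J)) *\<^sub>R a i) powr q \<le> (\<Sum>i\<in>J. (1 / real (card J)) * a i powr q)"
      using False n assms by (intro convex_on_sum[OF _ _ powr_convex]) auto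
    then have "(s / real (card J)) powr q \<le> (\<Sum>i\<in>J. a i powr q) / real (card J)"
      by (simp add: s_def sum_divide_distrib)
    then have "real (card J) powr (1 - q) * s powr q \<le> (\<Sum>i\<in>J. a i powr q)"
      using n s by (simp add: powr_divide powr_diff field_simps)
    moreover have "min 1 (real m powr (1 - q)) * s powr q \<le> real (card J) powr (1 - q) * s powr q"
    proof (intro mult_right_mono)
      have "real m powr (1 - q) \<le> real (card J) powr (1 - q)"
        using False n assms by (intro powr_mono2') auto
      then show "min 1 (real m powr (1 - q)) \<le> real (card J) powr (1 - q)"
        by linarith
    qed simp
    ultimately show ?thesis
      by (simp add: s_def)
  qed
qed simp

section \<open>Quasi-Fejer monotone sequences\<close>

text \<open>Up to a convergent series, the squared distance to each point of \<open>S\<close> decreases, hence it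
  converges. So the sequence is bounded; and the distance to one of its cluster points, which
  belongs to \<open>S\<close>, has a limit, which the subsequence shows to be zero.\<close>

lemma quasi_fejer_convergent:
  fixes x :: "nat \<Rightarrow> 'a::euclidean_space"
  assumes "summable e" and "S \<noteq> {}"
    and fejer: "\<And>z k. z \<in> S \<Longrightarrow> (norm (x (Suc k) - z))\<^sup>2 \<le> (norm (x k - z))\<^sup>2 + e k"
    and cluster: "\<And>r l. strict_mono r \<Longrightarrow> (x \<circ> r) \<longlonglongrightarrow> l \<Longrightarrow> l \<in> S"
  shows "\<exists>l\<in>S. x \<longlonglongrightarrow> l"
proof -
  have conv: "convergent (\<lambda>k. (norm (x k - z))\<^sup>2)" if z: "z \<in> S" for z
  proof -
    define E where "E k = (\<Sum>j<k. e j)" for k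
    have E: "convergent E"
      using \<open>summable e\<close> unfolding E_def by (simp add: summable_iff_convergent)
    then obtain B where B: "\<And>k. norm (E k) \<le> B"
      using convergent_imp_Bseq BseqE by blast
    have "decseq (\<lambda>k. (norm (x k - z))\<^sup>2 - E k)"
      unfolding decseq_Suc_iff E_def using fejer[OF z] by (simp add: algebra_simps)
    moreover have "- B \<le> (norm (x k - z))\<^sup>2 - E k" for k
      using B[of k] zero_le_power2[of "norm (x k - z)"] unfolding real_norm_def by linarith
    ultimately obtain l where "(\<lambda>k. (norm (x k - z))\<^sup>2 - E k) \<longlonglongrightarrow> l"
      using decseq_convergent by blast
    then have "convergent (\<lambda>k. ((norm (x k - z))\<^sup>2 - E k) + E k)"
      using E by (intro convergent_add) (auto simp: convergent_def)
    then show ?thesis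
      by simp
  qed
  obtain z where z: "z \<in> S"
    using \<open>S \<noteq> {}\<close> by blast
  obtain B where B: "\<And>k. norm ((norm (x k - z))\<^sup>2) \<le> B"
    using convergent_imp_Bseq[OF conv[OF z]] BseqE by blast
  have "norm (x k - z) \<le> sqrt B" for k
    using B[of k] by (intro real_le_rsqrt) simp
  then have "x k \<in> cball z (sqrt B)" for k
    by (simp add: dist_norm norm_minus_commute)
  then obtain l r where r: "strict_mono r" and lim: "(x \<circ> r) \<longlonglongrightarrow> l"
    using compact_cball[of z "sqrt B"] unfolding compact_def by blast
  then have l: "l \<in> S"
    using cluster by blast
  obtain c where c: "(\<lambda>k. (norm (x k - l))\<^sup>2) \<longlonglongrightarrow> c"
    using conv[OF l] by (auto simp: convergent_def)
  have "(\<lambda>k. (norm ((x \<circ> r) k - l))\<^sup>2) \<longlonglongrightarrow> (norm (l - l))\<^sup>2"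
    using lim by (intro tendsto_intros)
  moreover have "(\<lambda>k. (norm ((x \<circ> r) k - l))\<^sup>2) \<longlonglongrightarrow> c"
    using LIMSEQ_subseq_LIMSEQ[OF c r] by (simp add: o_def)
  ultimately have "(norm (l - l))\<^sup>2 = c"
    by (rule LIMSEQ_unique)
  then have "c = 0"
    by simp
  then have "(\<lambda>k. sqrt ((norm (x k - l))\<^sup>2)) \<longlonglongrightarrow> sqrt 0"
    using c by (intro tendsto_real_sqrt) simp
  then have "x \<longlonglongrightarrow> l"
    by (simp add: LIM_zero_iff tendsto_norm_zero_iff)
  then show ?thesis
    using l by blast
qed

section \<open>Conditioning on the past\<close>

text \<open>By monotone convergence the sum of the series has finite expectation.\<close>

lemma AE_summable:
  fixes f :: "nat \<Rightarrow> 'w \<Rightarrow> real"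
  assumes int: "\<And>k. integrable M (f k)" and nonneg: "\<And>k \<omega>. 0 \<le> f k \<omega>"
    and bound: "\<And>n. (\<Sum>k<n. integral\<^sup>L M (f k)) \<le> B"
  shows "AE \<omega> in M. summable (\<lambda>k. f k \<omega>)"
proof -
  have [measurable]: "f k \<in> borel_measurable M" for k
    using int by blast
  have nn: "(\<integral>\<^sup>+\<omega>. ennreal (f k \<omega>) \<partial>M) = ennreal (integral\<^sup>L M (f k))" for k
    using int nonneg by (intro nn_integral_eq_integral) auto
  have int_nonneg: "0 \<le> integral\<^sup>L M (f k)" for k
    using nonneg by (intro integral_nonneg_AE) auto
  have "(\<integral>\<^sup>+\<omega>. (\<Sum>k. ennreal (f k \<omega>)) \<partial>M) = (\<Sum>k. ennreal (integral\<^sup>L M (f k)))"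
    by (subst nn_integral_suminf) (auto simp: nn)
  also have "\<dots> \<le> ennreal B"
  proof (rule suminf_le_const)
    fix n
    have "(\<Sum>k<n. ennreal (integral\<^sup>L M (f k))) = ennreal (\<Sum>k<n. integral\<^sup>L M (f k))"
      using int_nonneg by (simp add: sum_ennreal)
    then show "(\<Sum>k<n. ennreal (integral\<^sup>L M (f k))) \<le> ennreal B"
      using bound by (simp add: ennreal_leI)
  qed auto
  finally have "(\<integral>\<^sup>+\<omega>. (\<Sum>k. ennreal (f k \<omega>)) \<partial>M) \<noteq> \<infinity>"
    by (auto simp: top_unique)
  then have "AE \<omega> in M. (\<Sum>k. ennreal (f k \<omega>)) \<noteq> \<infinity>"
    by (intro nn_integral_PInf_AE) auto
  then show ?thesis
    by eventually_elim (use nonneg summable_suminf_not_top in auto)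
qed

lemma measurable_history:
  "x k \<in> borel_measurable (history M x k)"
proof -
  have "(\<lambda>\<omega>. \<lambda>j\<in>{..k}. x j \<omega>) \<in> measurable (history M x k) (PiM {..k} (\<lambda>_. borel))"
    unfolding history_def by (rule measurable_vimage_algebra1) (auto simp: space_PiM)
  then have "(\<lambda>\<omega>. (\<lambda>j\<in>{..k}. x j \<omega>) k) \<in> borel_measurable (history M x k)"
    by (rule measurable_compose[OF _ measurable_component_singleton]) simp
  then show ?thesis
    by simp
qed

lemma subalgebra_history:
  assumes "\<And>j. x j \<in> borel_measurable M"
  shows "subalgebra M (history M x k)"
proof -
  have "(\<lambda>\<omega>. \<lambda>j\<in>{..k}. x j \<omega>) \<in> measurable M (PiM {..k} (\<lambda>_. borel))"
    using assms by (intro measurable_restrict) auto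
  then have "(\<lambda>\<omega>. \<omega>) \<in> measurable M (history M x k)"
    unfolding history_def by (intro measurable_vimage_algebra2) auto
  then have "(\<lambda>\<omega>. \<omega>) -` A \<inter> space M \<in> sets M" if "A \<in> sets (history M x k)" for A
    using that by (rule measurable_sets)
  moreover have "(\<lambda>\<omega>. \<omega>) -` A \<inter> space M = A" if "A \<in> sets (history M x k)" for A
    using sets.sets_into_space[OF that] by (auto simp: history_def)
  ultimately have "A \<in> sets M" if "A \<in> sets (history M x k)" for A
    using that by metis
  then show ?thesis
    by (auto simp: subalgebra_def history_def)
qed

text \<open>The prescribed conditional probability \<open>w\<close> is needed only where the weight \<open>h\<close> does not
  vanish, because the law of the index is prescribed only while the loop is running.\<close>

lemma (in prob_space) integral_conditional_prob:
  fixes h w :: "'a \<Rightarrow> real"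
  assumes "subalgebra M F" and h: "h \<in> borel_measurable F" and "A \<in> sets M"
    and w: "w \<in> borel_measurable M"
    and bound: "\<And>\<omega>. \<omega> \<in> space M \<Longrightarrow> \<bar>h \<omega>\<bar> \<le> B"
    and cond: "AE \<omega> in M. h \<omega> \<noteq> 0 \<longrightarrow> real_cond_exp M F (indicator A) \<omega> = w \<omega>"
  shows "(\<integral>\<omega>. h \<omega> * indicator A \<omega> \<partial>M) = (\<integral>\<omega>. h \<omega> * w \<omega> \<partial>M)"
proof -
  interpret finite_measure_subalgebra M F
    by unfold_locales fact
  have [measurable]: "h \<in> borel_measurable M" "A \<in> sets M" "w \<in> borel_measurable M"
    using measurable_from_subalg[OF \<open>subalgebra M F\<close> h] assms by auto
  have "integrable M (\<lambda>\<omega>. h \<omega> * indicator A \<omega>)"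
  proof (rule integrable_const_bound)
    show "AE \<omega> in M. norm (h \<omega> * indicator A \<omega>) \<le> \<bar>B\<bar>"
      by (intro AE_I2) (use bound in \<open>force simp: indicator_def\<close>)
  qed measurable
  then have "(\<integral>\<omega>. h \<omega> * indicator A \<omega> \<partial>M) = (\<integral>\<omega>. h \<omega> * real_cond_exp M F (indicator A) \<omega> \<partial>M)"
    using h by (subst real_cond_exp_intg(2)) auto
  also have "\<dots> = (\<integral>\<omega>. h \<omega> * w \<omega> \<partial>M)"
    using cond by (intro integral_cong_AE) auto
  finally show ?thesis .
qed

section \<open>Analysis of the method\<close>

locale incremental_subgradient = prob_space M
  for M :: "'w measure" +
  fixes X :: "'a::euclidean_space set" and m :: nat and f :: "nat \<Rightarrow> 'a \<Rightarrow> real"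
    and p :: real and L :: "nat \<Rightarrow> real"
    and \<gamma> :: "nat \<Rightarrow> real" and \<gamma>_lo \<gamma>_hi :: real
    and x0 :: 'a and v :: "nat \<Rightarrow> 'w \<Rightarrow> real" and x g :: "nat \<Rightarrow> 'w \<Rightarrow> 'a"
    and idx :: "nat \<Rightarrow> 'w \<Rightarrow> nat"
  assumes closed_X: "closed X" and convex_X: "convex X" and nonempty_X: "X \<noteq> {}"
    and m_pos: "m \<ge> 1"
    and continuous_f: "\<And>i. i \<in> {1..m} \<Longrightarrow> continuous_on UNIV (f i)"
    and common: "common_optimal X m f"
    and p_pos: "p > 0" and L_pos: "\<And>i. i \<in> {1..m} \<Longrightarrow> L i > 0"
    and holder: "\<And>i. i \<in> {1..m} \<Longrightarrow> holder_condition X p (L i) (f i)"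
    and \<gamma>_lo_pos: "0 < \<gamma>_lo" and \<gamma>_ge: "\<And>k. \<gamma>_lo \<le> \<gamma> k"
    and \<gamma>_le: "\<And>k. \<gamma> k \<le> \<gamma>_hi" and \<gamma>_hi_less: "\<gamma>_hi < 2"
    and start: "x0 \<in> X \<or> objective m f x0 > optimal_value X (objective m f)"
    and run: "incremental_subgradient_run X m f M x0 v x idx g"
    and stepsize: "\<And>k \<omega>. \<omega> \<in> space M \<Longrightarrow>
           v k \<omega> = \<gamma> k * (R_const p m L / real m) *
             (objective m f (x k \<omega>) - optimal_value X (objective m f)) powr (1 / p)"
begin

abbreviation "active \<equiv> active_set X m f"

abbreviation "f_min \<equiv> optimal_value X (objective m f)"

abbreviation "minimisers \<equiv> optimal_set X (objective m f)"

text \<open>At a point \<open>y\<close> where \<open>f i\<close> exceeds its minimum, this is the radius of a ball around any common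
  minimiser on which \<open>f i\<close> stays below \<open>f i y\<close>.\<close>

definition slack_radius :: "nat \<Rightarrow> 'a \<Rightarrow> real" where
  "slack_radius i y = ((f i y - optimal_value X (f i)) / Max (L ` {1..m})) powr (1 / p)"

definition draw_prob :: "nat \<Rightarrow> 'a \<Rightarrow> real" where
  "draw_prob i y = indicator (active y) i / real (card (active y))"

definition mean_radius :: "'a \<Rightarrow> real" where
  "mean_radius y = (\<Sum>i=1..m. draw_prob i y * slack_radius i y)"

definition base_step :: "'a \<Rightarrow> real" where
  "base_step y = R_const p m L / real m * (objective m f y - f_min) powr (1 / p)"

lemma minimisers_iff: "z \<in> minimisers \<longleftrightarrow> (\<forall>i\<in>{1..m}. z \<in> optimal_set X (f i))"
  using optimal_set_objective[OF common m_pos] by simp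

lemma minimisers_nonempty: "minimisers \<noteq> {}"
  using optimal_set_objective[OF common m_pos] common by (simp add: common_optimal_def)

lemma minimisers_value:
  assumes "z \<in> minimisers" and "i \<in> {1..m}"
  shows "f i z = optimal_value X (f i)"
  using assms optimal_value_eq[of z X "f i"] by (simp add: minimisers_iff)

lemma L_le_Max: "i \<in> {1..m} \<Longrightarrow> L i \<le> Max (L ` {1..m})"
  by (intro Max_ge) auto

lemma Max_L_pos: "Max (L ` {1..m}) > 0"
proof -
  have "1 \<in> {1..m}"
    using m_pos by simp
  then show ?thesis
    using L_pos L_le_Max by (meson less_le_trans)
qed

lemma R_const_pos: "R_const p m L > 0"
  using Max_L_pos m_pos by (simp add: R_const_def)

lemma \<gamma>_pos: "\<gamma> k > 0"
  using \<gamma>_lo_pos \<gamma>_ge[of k] by simp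

lemma active_subset: "active y \<subseteq> {1..m}"
  by (auto simp: active_set_def)

lemma finite_active: "finite (active y)"
  using finite_subset[OF active_subset] by simp

lemma card_active_le: "card (active y) \<le> m"
  using card_mono[OF _ active_subset, of y] by simp

lemma holder_Max:
  assumes i: "i \<in> {1..m}"
  shows "holder_condition X p (Max (L ` {1..m})) (f i)"
  unfolding holder_condition_def
proof (intro ballI allI)
  fix a b assume "a \<in> X"
  then have "\<bar>f i b - f i a\<bar> \<le> L i * norm (b - a) powr p"
    using holder[OF i] by (simp add: holder_condition_def)
  also have "\<dots> \<le> Max (L ` {1..m}) * norm (b - a) powr p"
    using L_le_Max[OF i] by (intro mult_right_mono) auto
  finally show "\<bar>f i b - f i a\<bar> \<le> Max (L ` {1..m}) * norm (b - a) powr p" .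
qed

lemma slack_radius_nonneg: "slack_radius i y \<ge> 0"
  by (simp add: slack_radius_def)

text \<open>A ball on which \<open>f i\<close> stays below \<open>f i y\<close> cannot contain \<open>y\<close>.\<close>

lemma slack_radius_le_dist:
  assumes "z \<in> minimisers" and "i \<in> active y"
  shows "slack_radius i y \<le> norm (y - z)"
proof -
  have i: "i \<in> {1..m}" "f i y > optimal_value X (f i)"
    using assms by (auto simp: active_set_def)
  have "\<bar>f i y - f i z\<bar> \<le> Max (L ` {1..m}) * norm (y - z) powr p"
    using holder_Max[OF i(1)] optimal_setD(1)[OF assms(1)] unfolding holder_condition_def by blast
  then have "(f i y - optimal_value X (f i)) / Max (L ` {1..m}) \<le> norm (y - z) powr p"
    using Max_L_pos by (simp add: minimisers_value[OF assms(1) i(1)] field_simps)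
  then have "slack_radius i y \<le> (norm (y - z) powr p) powr (1 / p)"
    unfolding slack_radius_def using i Max_L_pos p_pos by (intro powr_mono2) auto
  also have "\<dots> = norm (y - z)"
    using p_pos by (simp add: powr_powr)
  finally show ?thesis .
qed

lemma slack_radius_le_inner:
  assumes "z \<in> minimisers" and "i \<in> active y" and "u \<in> quasi_subdiff (f i) y" and "norm u = 1"
  shows "slack_radius i y \<le> inner u (y - z)"
proof -
  have i: "i \<in> {1..m}" "f i y > optimal_value X (f i)"
    using assms by (auto simp: active_set_def)
  have eq: "f i z = optimal_value X (f i)"
    using minimisers_value[OF assms(1) i(1)] .
  from quasi_subgradient_inner_ge[OF holder_Max[OF i(1)] Max_L_pos p_pos optimal_setD(1)[OF assms(1)], of y u]
  show ?thesis
    using assms i eq by (simp add: slack_radius_def)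
qed

lemma sum_draw_prob:
  "(\<Sum>i=1..m. draw_prob i y * h i) = (\<Sum>i\<in>active y. h i) / real (card (active y))"
proof -
  have "(\<Sum>i=1..m. draw_prob i y * h i) = (\<Sum>i\<in>active y. draw_prob i y * h i)"
    using active_subset by (intro sum.mono_neutral_right) (auto simp: draw_prob_def)
  then show ?thesis
    by (simp add: draw_prob_def sum_divide_distrib)
qed

lemma mean_radius_le_dist:
  assumes "z \<in> minimisers"
  shows "mean_radius y \<le> norm (y - z)"
proof -
  have "(\<Sum>i\<in>active y. slack_radius i y) \<le> real (card (active y)) * norm (y - z)"
    using slack_radius_le_dist[OF assms] by (intro sum_bounded_above) auto
  then show ?thesis
    unfolding mean_radius_def sum_draw_prob
    by (cases "card (active y) = 0") (auto simp: field_simps)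
qed

text \<open>Inactive indices have nonpositive gap, so the gap of the sum is at most the sum of the active
  gaps, to which \<open>sum_powr_ge\<close> applies. Dividing by \<open>m\<close> rather than by the number of active
  indices only makes the step shorter.\<close>

lemma base_step_le_mean_radius:
  assumes "f_min \<le> objective m f y"
  shows "base_step y \<le> mean_radius y"
proof -
  define a where "a i = f i y - optimal_value X (f i)" for i
  define q where "q = 1 / p"
  have q: "q > 0"
    using p_pos by (simp add: q_def)
  have a: "a i > 0" if "i \<in> active y" for i
    using that by (simp add: active_set_def a_def)
  have "objective m f y - f_min = (\<Sum>i=1..m. a i)"
    using optimal_value_objective[OF common m_pos]
    by (simp add: a_def objective_def sum_subtractf)
  also have "\<dots> \<le> (\<Sum>i\<in>active y. a i)"
  proof -
    have "(\<Sum>i=1..m. a i) = (\<Sum>i\<in>active y. a i) + (\<Sum>i\<in>{1..m} - active y. a i)"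
      using active_subset by (metis add.commute finite_atLeastAtMost sum.subset_diff)
    moreover have "(\<Sum>i\<in>{1..m} - active y. a i) \<le> 0"
      by (intro sum_nonpos) (auto simp: active_set_def a_def)
    ultimately show ?thesis
      by simp
  qed
  finally have gap: "objective m f y - f_min \<le> (\<Sum>i\<in>active y. a i)" .
  show ?thesis
  proof (cases "active y = {}")
    case True
    then have "objective m f y - f_min = 0"
      using gap assms by simp
    then have "base_step y = 0"
      by (simp add: base_step_def)
    then show ?thesis
      using True by (simp add: mean_radius_def draw_prob_def)
  next
    case False
    define n where "n = card (active y)"
    have n: "n > 0" "n \<le> m"
      using False finite_active card_active_le by (auto simp: n_def card_gt_0_iff)
    define \<mu> where "\<mu> = min 1 (real m powr (1 - q))"
    define K where "K = Max (L ` {1..m}) powr (- q)"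
    have \<mu>: "\<mu> \<ge> 0"
      by (simp add: \<mu>_def)
    have R: "R_const p m L = K * \<mu>"
      by (simp add: R_const_def K_def \<mu>_def q_def)
    have "\<mu> * (objective m f y - f_min) powr q \<le> \<mu> * (\<Sum>i\<in>active y. a i) powr q"
      using gap assms q \<mu> by (intro mult_left_mono powr_mono2) auto
    also have "\<dots> \<le> (\<Sum>i\<in>active y. a i powr q)"
      unfolding \<mu>_def using a q finite_active card_active_le by (intro sum_powr_ge) auto
    finally have "K * (\<mu> * (objective m f y - f_min) powr q) \<le> K * (\<Sum>i\<in>active y. a i powr q)"
      by (intro mult_left_mono) (auto simp: K_def)
    also have "\<dots> = (\<Sum>i\<in>active y. slack_radius i y)"
      unfolding sum_distrib_left
    proof (intro sum.cong refl)
      fix i assume "i \<in> active y"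
      then show "K * a i powr q = slack_radius i y"
        using a[of i] Max_L_pos
        by (simp add: slack_radius_def K_def powr_divide powr_minus field_simps flip: a_def q_def)
    qed
    finally have "base_step y \<le> (\<Sum>i\<in>active y. slack_radius i y) / real m"
      using m_pos by (simp add: base_step_def R q_def[symmetric] field_simps)
    also have "\<dots> \<le> (\<Sum>i\<in>active y. slack_radius i y) / real n"
      using n slack_radius_nonneg by (intro divide_left_mono sum_nonneg) auto
    finally show ?thesis
      unfolding mean_radius_def sum_draw_prob n_def .
  qed
qed

lemma x_measurable [measurable]: "x k \<in> borel_measurable M"
  using run by (simp add: incremental_subgradient_run_def)

lemma idx_measurable [measurable]: "idx k \<in> measurable M (count_space UNIV)"
  using run by (simp add: incremental_subgradient_run_def)

lemma x_0: "\<omega> \<in> space M \<Longrightarrow> x 0 \<omega> = x0"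
  using run by (simp add: incremental_subgradient_run_def)

lemma x_running:
  assumes "\<omega> \<in> space M" and "objective m f (x k \<omega>) > f_min"
  shows "idx k \<omega> \<in> active (x k \<omega>)" and "g k \<omega> \<in> quasi_subdiff (f (idx k \<omega>)) (x k \<omega>)"
    and "norm (g k \<omega>) = 1" and "x (Suc k) \<omega> = closest_point X (x k \<omega> - v k \<omega> *\<^sub>R g k \<omega>)"
proof -
  have "idx k \<omega> \<in> active (x k \<omega>) \<and>
      g k \<omega> \<in> quasi_subdiff (f (idx k \<omega>)) (x k \<omega>) \<inter> sphere 0 1 \<and>
      x (Suc k) \<omega> = closest_point X (x k \<omega> - v k \<omega> *\<^sub>R g k \<omega>)"
    using run assms unfolding incremental_subgradient_run_def by presburger
  then show "idx k \<omega> \<in> active (x k \<omega>)" "g k \<omega> \<in> quasi_subdiff (f (idx k \<omega>)) (x k \<omega>)"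
    "norm (g k \<omega>) = 1" "x (Suc k) \<omega> = closest_point X (x k \<omega> - v k \<omega> *\<^sub>R g k \<omega>)"
    by auto
qed

lemma x_stopped:
  assumes "\<omega> \<in> space M" and "\<not> objective m f (x k \<omega>) > f_min"
  shows "x (Suc k) \<omega> = x k \<omega>"
  using run assms unfolding incremental_subgradient_run_def by presburger

lemma f_min_le: "y \<in> X \<Longrightarrow> f_min \<le> objective m f y"
proof -
  assume "y \<in> X"
  obtain z where "z \<in> minimisers"
    using minimisers_nonempty by blast
  then show ?thesis
    using optimal_value_eq optimal_setD(2) \<open>y \<in> X\<close> by metis
qed

lemma x_in_X_or_running:
  assumes "\<omega> \<in> space M"
  shows "x k \<omega> \<in> X \<or> (k = 0 \<and> objective m f (x k \<omega>) > f_min)"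
proof (induction k)
  case 0
  then show ?case
    using start x_0[OF assms] by auto
next
  case (Suc k)
  show ?case
  proof (cases "objective m f (x k \<omega>) > f_min")
    case True
    then show ?thesis
      using x_running(4)[OF assms True] closest_point_in_set[OF closed_X nonempty_X] by simp
  next
    case False
    then show ?thesis
      using Suc x_stopped[OF assms False] by auto
  qed
qed

lemma x_Suc_in_X: "\<omega> \<in> space M \<Longrightarrow> x (Suc k) \<omega> \<in> X"
  using x_in_X_or_running[of \<omega> "Suc k"] by simp

lemma f_min_le_x: "\<omega> \<in> space M \<Longrightarrow> f_min \<le> objective m f (x k \<omega>)"
  using x_in_X_or_running[of \<omega> k] f_min_le by auto

lemma v_eq: "\<omega> \<in> space M \<Longrightarrow> v k \<omega> = \<gamma> k * base_step (x k \<omega>)"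
  by (simp add: stepsize base_step_def mult.assoc)

lemma base_step_nonneg: "base_step y \<ge> 0"
  using R_const_pos by (simp add: base_step_def)

lemma v_nonneg: "\<omega> \<in> space M \<Longrightarrow> v k \<omega> \<ge> 0"
  using base_step_nonneg \<gamma>_pos by (simp add: v_eq less_imp_le)

lemma v_stopped:
  assumes "\<omega> \<in> space M" and "\<not> objective m f (x k \<omega>) > f_min"
  shows "v k \<omega> = 0"
proof -
  have "objective m f (x k \<omega>) = f_min"
    using assms f_min_le_x[OF assms(1), of k] by linarith
  then show ?thesis
    using assms by (simp add: stepsize)
qed

subsection \<open>Pathwise estimates\<close>

text \<open>The drawn index enters through the indicators of the events \<open>idx k = i\<close>, since these are
  what the conditional law of the draw speaks about. At most one summand is nonzero.\<close>

lemma step_dist: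
  assumes "z \<in> minimisers" and "\<omega> \<in> space M"
  shows "(norm (x (Suc k) \<omega> - z))\<^sup>2 \<le> (norm (x k \<omega> - z))\<^sup>2
    - 2 * (\<Sum>i=1..m. v k \<omega> * indicator (active (x k \<omega>)) i * slack_radius i (x k \<omega>)
             * indicator {\<omega>' \<in> space M. idx k \<omega>' = i} \<omega>) + (v k \<omega>)\<^sup>2"
proof (cases "objective m f (x k \<omega>) > f_min")
  case True
  note running = x_running[OF assms(2) True]
  have "(\<Sum>i=1..m. v k \<omega> * indicator (active (x k \<omega>)) i * slack_radius i (x k \<omega>)
             * indicator {\<omega>' \<in> space M. idx k \<omega>' = i} \<omega>)
      = (\<Sum>i=1..m. if i = idx k \<omega> then v k \<omega> * slack_radius (idx k \<omega>) (x k \<omega>) else 0)"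
    using running(1) assms(2) by (intro sum.cong refl) (auto simp: indicator_def)
  also have "\<dots> = v k \<omega> * slack_radius (idx k \<omega>) (x k \<omega>)"
    using subsetD[OF active_subset running(1)] by (simp add: sum.delta)
  also have "\<dots> \<le> v k \<omega> * inner (g k \<omega>) (x k \<omega> - z)"
    using slack_radius_le_inner[OF assms(1) running(1-3)] v_nonneg[OF assms(2)]
    by (intro mult_left_mono)
  finally show ?thesis
    using projected_step_dist[OF closed_X convex_X optimal_setD(1)[OF assms(1)] running(3),
        of "x k \<omega>" "v k \<omega>"] running(4) by simp
next
  case False
  then show ?thesis
    using x_stopped v_stopped assms by simp
qed

text \<open>Discarding the nonnegative inner product costs nothing for the convergence argument and
  leaves an estimate that holds for every outcome and every minimiser at once.\<close>

lemma step_dist_le: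
  assumes "z \<in> minimisers" and "\<omega> \<in> space M"
  shows "(norm (x (Suc k) \<omega> - z))\<^sup>2 \<le> (norm (x k \<omega> - z))\<^sup>2 + (v k \<omega>)\<^sup>2"
proof -
  have "(\<Sum>i=1..m. v k \<omega> * indicator (active (x k \<omega>)) i * slack_radius i (x k \<omega>)
             * indicator {\<omega>' \<in> space M. idx k \<omega>' = i} \<omega>) \<ge> 0"
    using v_nonneg[OF assms(2)] slack_radius_nonneg by (intro sum_nonneg) auto
  then show ?thesis
    using step_dist[OF assms, of k] by linarith
qed

lemma v_le_dist:
  assumes "z \<in> minimisers" and "\<omega> \<in> space M"
  shows "v k \<omega> \<le> 2 * norm (x k \<omega> - z)"
proof -
  have "base_step (x k \<omega>) \<le> norm (x k \<omega> - z)"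
    using base_step_le_mean_radius[OF f_min_le_x[OF assms(2)]] mean_radius_le_dist[OF assms(1)]
    by (rule order_trans)
  moreover have "\<gamma> k \<le> 2"
    using \<gamma>_le[of k] \<gamma>_hi_less by simp
  ultimately show ?thesis
    unfolding v_eq[OF assms(2)] using base_step_nonneg by (intro mult_mono) auto
qed

text \<open>The growth of this bound with \<open>k\<close> is harmless: it serves only to make the expectations
  at each single step finite.\<close>

lemma dist_bounded:
  assumes "z \<in> minimisers" and "\<omega> \<in> space M"
  shows "norm (x k \<omega> - z) \<le> 3 ^ k * norm (x0 - z)"
proof (induction k)
  case 0
  then show ?case
    using x_0[OF assms(2)] by simp
next
  case (Suc k)
  have "(v k \<omega>)\<^sup>2 \<le> (2 * norm (x k \<omega> - z))\<^sup>2"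
    using v_le_dist[OF assms] v_nonneg[OF assms(2)] by (intro power_mono) auto
  then have "(norm (x (Suc k) \<omega> - z))\<^sup>2 \<le> (norm (x k \<omega> - z))\<^sup>2 + (2 * norm (x k \<omega> - z))\<^sup>2"
    using step_dist_le[OF assms, of k] by linarith
  also have "\<dots> \<le> (3 * norm (x k \<omega> - z))\<^sup>2"
    by (simp add: power_mult_distrib)
  finally have "norm (x (Suc k) \<omega> - z) \<le> 3 * norm (x k \<omega> - z)"
    by (rule power2_le_imp_le) simp
  then show ?case
    using Suc by simp
qed

subsection \<open>Expected decrease and summability of the stepsizes\<close>

lemma f_measurable [measurable]: "i \<in> {1..m} \<Longrightarrow> f i \<in> borel_measurable borel"
  using continuous_f by (rule borel_measurable_continuous_onI)

lemma active_indicator_measurable [measurable]: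
  assumes "i \<in> {1..m}"
  shows "(\<lambda>y. indicator (active y) i :: real) \<in> borel_measurable borel"
proof -
  note f_measurable[OF assms, measurable]
  have "(\<lambda>y. indicator (active y) i :: real) = (\<lambda>y. if f i y > optimal_value X (f i) then 1 else 0)"
    using assms by (auto simp: active_set_def indicator_def fun_eq_iff)
  then show ?thesis
    by simp
qed

lemma draw_prob_measurable [measurable]:
  assumes "i \<in> {1..m}"
  shows "draw_prob i \<in> borel_measurable borel"
proof -
  have "real (card (active y)) = (\<Sum>i=1..m. indicator (active y) i)" for y
  proof -
    have "(\<Sum>i=1..m. indicator (active y) i :: real) = (\<Sum>i\<in>active y. 1)"
      using active_subset by (intro sum.mono_neutral_cong_right) auto
    then show ?thesis
      by simp
  qed
  then show ?thesis
    using assms unfolding draw_prob_def by (simp add: borel_measurable_divide borel_measurable_sum)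
qed

lemma slack_radius_measurable [measurable]:
  assumes "i \<in> {1..m}"
  shows "slack_radius i \<in> borel_measurable borel"
proof -
  note f_measurable[OF assms, measurable]
  show ?thesis
    unfolding slack_radius_def by measurable
qed

lemma base_step_measurable [measurable]: "base_step \<in> borel_measurable borel"
proof -
  have [measurable]: "objective m f \<in> borel_measurable borel"
    unfolding objective_def by (intro borel_measurable_sum f_measurable)
  show ?thesis
    unfolding base_step_def by measurable
qed

lemma v_measurable [measurable]: "v k \<in> borel_measurable M"
proof -
  have "(\<lambda>\<omega>. \<gamma> k * base_step (x k \<omega>)) \<in> borel_measurable M"
    by measurable
  then show ?thesis
    by (subst measurable_cong[OF v_eq])
qed

lemma integrable_dist:
  assumes "z \<in> minimisers"
  shows "integrable M (\<lambda>\<omega>. (norm (x k \<omega> - z))\<^sup>2)"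
proof (rule integrable_const_bound)
  show "AE \<omega> in M. norm ((norm (x k \<omega> - z))\<^sup>2) \<le> (3 ^ k * norm (x0 - z))\<^sup>2"
    using dist_bounded[OF assms] by (intro AE_I2) (simp add: power_mono del: power_mult_distrib)
qed measurable

lemma integrable_v2: "integrable M (\<lambda>\<omega>. (v k \<omega>)\<^sup>2)"
proof -
  obtain z where z: "z \<in> minimisers"
    using minimisers_nonempty by blast
  show ?thesis
  proof (rule Bochner_Integration.integrable_bound[OF integrable_mult_right[OF integrable_dist[OF z, of k], of 4]])
    show "AE \<omega> in M. norm ((v k \<omega>)\<^sup>2) \<le> norm (4 * (norm (x k \<omega> - z))\<^sup>2)"
    proof (intro AE_I2)
      fix \<omega> assume "\<omega> \<in> space M"
      then have "(v k \<omega>)\<^sup>2 \<le> (2 * norm (x k \<omega> - z))\<^sup>2"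
        using v_le_dist[OF z] v_nonneg by (intro power_mono) auto
      then show "norm ((v k \<omega>)\<^sup>2) \<le> norm (4 * (norm (x k \<omega> - z))\<^sup>2)"
        by (simp add: power_mult_distrib)
    qed
  qed measurable
qed

lemma weighted_radius_bound:
  assumes "z \<in> minimisers" and "\<omega> \<in> space M"
  shows "\<bar>v k \<omega> * indicator (active (x k \<omega>)) i * slack_radius i (x k \<omega>)\<bar>
    \<le> 2 * (3 ^ k * norm (x0 - z)) * (3 ^ k * norm (x0 - z))"
proof (cases "i \<in> active (x k \<omega>)")
  case True
  have "v k \<omega> \<le> 2 * (3 ^ k * norm (x0 - z))"
    using v_le_dist[OF assms, of k] dist_bounded[OF assms, of k] by linarith
  moreover have "slack_radius i (x k \<omega>) \<le> 3 ^ k * norm (x0 - z)"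
    using slack_radius_le_dist[OF assms(1) True] dist_bounded[OF assms, of k] by linarith
  ultimately have "v k \<omega> * slack_radius i (x k \<omega>) \<le> 2 * (3 ^ k * norm (x0 - z)) * (3 ^ k * norm (x0 - z))"
    using slack_radius_nonneg by (intro mult_mono) auto
  then show ?thesis
    using True v_nonneg[OF assms(2), of k] slack_radius_nonneg[of i "x k \<omega>"] by simp
qed simp

text \<open>Stepsize, active set and slack radius at \<open>x k\<close> are functions of the past, so the indicator of
  the draw may be replaced by its conditional probability. After the loop has ended the stepsize
  vanishes, and so do both integrands.\<close>

lemma expectation_draw:
  assumes i: "i \<in> {1..m}"
  shows "(\<integral>\<omega>. v k \<omega> * indicator (active (x k \<omega>)) i * slack_radius i (x k \<omega>)
             * indicator {\<omega>' \<in> space M. idx k \<omega>' = i} \<omega> \<partial>M)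
       = (\<integral>\<omega>. v k \<omega> * (draw_prob i (x k \<omega>) * slack_radius i (x k \<omega>)) \<partial>M)"
proof -
  obtain z where z: "z \<in> minimisers"
    using minimisers_nonempty by blast
  let ?F = "history M x k"
  let ?h = "\<lambda>\<omega>. v k \<omega> * indicator (active (x k \<omega>)) i * slack_radius i (x k \<omega>)"
  note [measurable] = active_indicator_measurable[OF i] slack_radius_measurable[OF i] draw_prob_measurable[OF i]
  have sub: "subalgebra M ?F"
    by (intro subalgebra_history x_measurable)
  have h: "?h \<in> borel_measurable ?F"
  proof -
    note measurable_history[of x k M, measurable]
    have "(\<lambda>\<omega>. \<gamma> k * base_step (x k \<omega>) * indicator (active (x k \<omega>)) i * slack_radius i (x k \<omega>))
        \<in> borel_measurable ?F"
      by measurable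
    then show ?thesis
      using sub v_eq by (subst measurable_cong) (auto simp: subalgebra_def)
  qed
  have "AE \<omega> in M. objective m f (x k \<omega>) > f_min \<longrightarrow>
        real_cond_exp M ?F (indicator {\<omega>' \<in> space M. idx k \<omega>' = i}) \<omega> = draw_prob i (x k \<omega>)"
    using run i unfolding incremental_subgradient_run_def draw_prob_def by blast
  then have "AE \<omega> in M. ?h \<omega> \<noteq> 0 \<longrightarrow>
        real_cond_exp M ?F (indicator {\<omega>' \<in> space M. idx k \<omega>' = i}) \<omega> = draw_prob i (x k \<omega>)"
    using AE_space by eventually_elim (use v_stopped in auto)
  from integral_conditional_prob[OF sub h _ _ weighted_radius_bound[OF z] this]
  have "(\<integral>\<omega>. ?h \<omega> * indicator {\<omega>' \<in> space M. idx k \<omega>' = i} \<omega> \<partial>M)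
      = (\<integral>\<omega>. ?h \<omega> * draw_prob i (x k \<omega>) \<partial>M)"
    by simp
  also have "\<dots> = (\<integral>\<omega>. v k \<omega> * (draw_prob i (x k \<omega>) * slack_radius i (x k \<omega>)) \<partial>M)"
    by (intro Bochner_Integration.integral_cong refl) (simp add: draw_prob_def indicator_def)
  finally show ?thesis .
qed

text \<open>The expected gain from the inner products is at least \<open>2 E (v k)\<^sup>2 / \<gamma>_hi\<close>, because
  \<open>mean_radius (x k) \<ge> v k / \<gamma> k\<close>; since \<open>\<gamma>_hi < 2\<close>, it outweighs the loss \<open>E (v k)\<^sup>2\<close>.\<close>

lemma expected_decrease:
  assumes z: "z \<in> minimisers"
  shows "(\<integral>\<omega>. (norm (x (Suc k) \<omega> - z))\<^sup>2 \<partial>M)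
    \<le> (\<integral>\<omega>. (norm (x k \<omega> - z))\<^sup>2 \<partial>M) - (2 / \<gamma>_hi - 1) * (\<integral>\<omega>. (v k \<omega>)\<^sup>2 \<partial>M)"
proof -
  let ?h = "\<lambda>i \<omega>. v k \<omega> * indicator (active (x k \<omega>)) i * slack_radius i (x k \<omega>)
             * indicator {\<omega>' \<in> space M. idx k \<omega>' = i} \<omega>"
  let ?w = "\<lambda>i \<omega>. v k \<omega> * (draw_prob i (x k \<omega>) * slack_radius i (x k \<omega>))"
  let ?C = "2 * (3 ^ k * norm (x0 - z)) * (3 ^ k * norm (x0 - z))"
  have C: "?C \<ge> 0"
    by simp
  have int_h: "integrable M (?h i)" if i: "i \<in> {1..m}" for i
  proof (rule integrable_const_bound)
    note [measurable] = active_indicator_measurable[OF i] slack_radius_measurable[OF i]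
    show "?h i \<in> borel_measurable M"
      by measurable
    show "AE \<omega> in M. norm (?h i \<omega>) \<le> ?C"
    proof (intro AE_I2)
      fix \<omega> assume "\<omega> \<in> space M"
      then show "norm (?h i \<omega>) \<le> ?C"
        using weighted_radius_bound[OF z, of \<omega> k i] C
        by (cases "idx k \<omega> = i") simp_all
    qed
  qed
  have int_w: "integrable M (?w i)" if i: "i \<in> {1..m}" for i
  proof (rule integrable_const_bound)
    note [measurable] = draw_prob_measurable[OF i] slack_radius_measurable[OF i]
    show "?w i \<in> borel_measurable M"
      by measurable
    show "AE \<omega> in M. norm (?w i \<omega>) \<le> ?C"
    proof (intro AE_I2)
      fix \<omega> assume \<omega>: "\<omega> \<in> space M"
      define a where "a = v k \<omega> * indicator (active (x k \<omega>)) i * slack_radius i (x k \<omega>)"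
      define b where "b = 1 / real (card (active (x k \<omega>)))"
      have "?w i \<omega> = a * b"
        by (simp add: draw_prob_def a_def b_def)
      moreover have "\<bar>a\<bar> \<le> ?C"
        unfolding a_def by (rule weighted_radius_bound[OF z \<omega>])
      moreover have "\<bar>b\<bar> \<le> 1"
        by (cases "card (active (x k \<omega>)) = 0") (auto simp: b_def)
      ultimately have "\<bar>?w i \<omega>\<bar> \<le> ?C * 1"
        using mult_mono[of "\<bar>a\<bar>" ?C "\<bar>b\<bar>" 1] C by (simp only: abs_mult abs_ge_zero)
      then show "norm (?w i \<omega>) \<le> ?C"
        by simp
    qed
  qed
  have "(\<integral>\<omega>. (v k \<omega>)\<^sup>2 / \<gamma>_hi \<partial>M) \<le> (\<integral>\<omega>. (\<Sum>i=1..m. ?w i \<omega>) \<partial>M)"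
  proof (rule integral_mono)
    fix \<omega> assume \<omega>: "\<omega> \<in> space M"
    have "(v k \<omega>)\<^sup>2 / \<gamma>_hi \<le> (v k \<omega>)\<^sup>2 / \<gamma> k"
      using \<gamma>_le \<gamma>_pos by (intro frac_le) auto
    also have "\<dots> = v k \<omega> * base_step (x k \<omega>)"
      using \<gamma>_pos[of k] v_eq[OF \<omega>, of k] by (simp add: power2_eq_square)
    also have "\<dots> \<le> v k \<omega> * mean_radius (x k \<omega>)"
      using base_step_le_mean_radius[OF f_min_le_x[OF \<omega>]] v_nonneg[OF \<omega>] by (intro mult_left_mono)
    finally show "(v k \<omega>)\<^sup>2 / \<gamma>_hi \<le> (\<Sum>i=1..m. ?w i \<omega>)"
      by (simp add: mean_radius_def sum_distrib_left)
  qed (use int_w integrable_v2 in auto)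
  also have "\<dots> = (\<Sum>i=1..m. \<integral>\<omega>. ?h i \<omega> \<partial>M)"
    using int_w expectation_draw by (subst Bochner_Integration.integral_sum) auto
  finally have drop: "(\<integral>\<omega>. (v k \<omega>)\<^sup>2 \<partial>M) / \<gamma>_hi \<le> (\<Sum>i=1..m. \<integral>\<omega>. ?h i \<omega> \<partial>M)"
    by simp
  define S where "S = (\<lambda>\<omega>. \<Sum>i=1..m. ?h i \<omega>)"
  have S: "integrable M S" "(\<integral>\<omega>. S \<omega> \<partial>M) = (\<Sum>i=1..m. \<integral>\<omega>. ?h i \<omega> \<partial>M)"
    unfolding S_def
    by (rule Bochner_Integration.integrable_sum[OF int_h], assumption)
      (rule Bochner_Integration.integral_sum[OF int_h], assumption)
  have "(\<integral>\<omega>. (norm (x (Suc k) \<omega> - z))\<^sup>2 \<partial>M)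
      \<le> (\<integral>\<omega>. (norm (x k \<omega> - z))\<^sup>2 - 2 * S \<omega> + (v k \<omega>)\<^sup>2 \<partial>M)"
  proof (rule integral_mono)
    fix \<omega> assume "\<omega> \<in> space M"
    then show "(norm (x (Suc k) \<omega> - z))\<^sup>2 \<le> (norm (x k \<omega> - z))\<^sup>2 - 2 * S \<omega> + (v k \<omega>)\<^sup>2"
      unfolding S_def by (rule step_dist[OF z])
  qed (use S integrable_v2 integrable_dist[OF z] in auto)
  also have "\<dots> = (\<integral>\<omega>. (norm (x k \<omega> - z))\<^sup>2 \<partial>M) - 2 * (\<Sum>i=1..m. \<integral>\<omega>. ?h i \<omega> \<partial>M) + (\<integral>\<omega>. (v k \<omega>)\<^sup>2 \<partial>M)"
    using S(1) integrable_v2[of k] integrable_dist[OF z, of k] unfolding S(2)[symmetric] by simp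
  finally show ?thesis
    using drop by (simp add: algebra_simps)
qed

lemma AE_summable_v2: "AE \<omega> in M. summable (\<lambda>k. (v k \<omega>)\<^sup>2)"
proof -
  obtain z where z: "z \<in> minimisers"
    using minimisers_nonempty by blast
  define D where "D k = (\<integral>\<omega>. (norm (x k \<omega> - z))\<^sup>2 \<partial>M)" for k
  define c where "c = 2 / \<gamma>_hi - 1"
  have c: "c > 0"
    using \<gamma>_hi_less \<gamma>_pos[of 0] \<gamma>_le[of 0] by (simp add: c_def field_simps)
  have "c * (\<Sum>k<n. \<integral>\<omega>. (v k \<omega>)\<^sup>2 \<partial>M) \<le> D 0 - D n" for n
  proof (induction n)
    case (Suc n)
    then show ?case
      using expected_decrease[OF z, of n] by (simp add: D_def c_def algebra_simps)
  qed simp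
  moreover have "D n \<ge> 0" for n
    by (simp add: D_def)
  ultimately have "(\<Sum>k<n. \<integral>\<omega>. (v k \<omega>)\<^sup>2 \<partial>M) \<le> D 0 / c" for n
    using c by (smt (verit) mult.commute pos_le_divide_eq)
  then show ?thesis
    by (intro AE_summable[OF integrable_v2]) auto
qed

subsection \<open>Convergence of almost every path\<close>

text \<open>Along the whole path the objective tends to its minimum, because the stepsize is at least
  \<open>\<gamma>_lo\<close> times a fixed multiple of a power of the gap.\<close>

lemma cluster_point_minimiser:
  assumes \<omega>: "\<omega> \<in> space M" and "summable (\<lambda>k. (v k \<omega>)\<^sup>2)"
    and r: "strict_mono r" and lim: "((\<lambda>k. x k \<omega>) \<circ> r) \<longlonglongrightarrow> l"
  shows "l \<in> minimisers"
proof -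
  define gap where "gap k = objective m f (x k \<omega>) - f_min" for k
  have gap: "gap k \<ge> 0" for k
    using f_min_le_x[OF \<omega>] by (simp add: gap_def)
  have "(\<lambda>k. sqrt ((v k \<omega>)\<^sup>2)) \<longlonglongrightarrow> sqrt 0"
    using summable_LIMSEQ_zero[OF assms(2)] by (rule tendsto_real_sqrt)
  then have "(\<lambda>k. v k \<omega>) \<longlonglongrightarrow> 0"
    using v_nonneg[OF \<omega>] by simp
  then have "(\<lambda>k. v k \<omega> / \<gamma>_lo * (real m / R_const p m L)) \<longlonglongrightarrow> 0 / \<gamma>_lo * (real m / R_const p m L)"
    using \<gamma>_lo_pos by (intro tendsto_intros) auto
  then have upper: "(\<lambda>k. v k \<omega> / \<gamma>_lo * (real m / R_const p m L)) \<longlonglongrightarrow> 0"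
    by simp
  have le: "gap k powr (1 / p) \<le> v k \<omega> / \<gamma>_lo * (real m / R_const p m L)" for k
  proof -
    have "\<gamma>_lo * base_step (x k \<omega>) \<le> v k \<omega>"
      unfolding v_eq[OF \<omega>] using \<gamma>_ge base_step_nonneg by (intro mult_right_mono)
    then show ?thesis
      using \<gamma>_lo_pos R_const_pos m_pos by (simp add: base_step_def gap_def field_simps)
  qed
  have "(\<lambda>k. gap k powr (1 / p)) \<longlonglongrightarrow> 0"
    by (rule tendsto_sandwich[OF _ _ tendsto_const upper]) (use le in auto)
  then have "(\<lambda>k. (gap k powr (1 / p)) powr p) \<longlonglongrightarrow> 0"
    by (rule tendsto_zero_powrI[OF _ tendsto_const _ p_pos]) simp
  then have "gap \<longlonglongrightarrow> 0"
    using p_pos gap by (simp add: powr_powr)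
  then have "(\<lambda>k. gap (r k)) \<longlonglongrightarrow> 0"
    using LIMSEQ_subseq_LIMSEQ[OF _ r] by (auto simp: o_def)
  moreover have "(\<lambda>k. gap (r k)) \<longlonglongrightarrow> objective m f l - f_min"
  proof -
    have "(\<lambda>k. f i (x (r k) \<omega>)) \<longlonglongrightarrow> f i l" if "i \<in> {1..m}" for i
      using continuous_on_tendsto_compose[OF continuous_f[OF that] lim] by (simp add: o_def)
    then show ?thesis
      unfolding gap_def objective_def by (intro tendsto_intros)
  qed
  ultimately have "0 = objective m f l - f_min"
    by (rule LIMSEQ_unique)
  then have "objective m f l = f_min"
    by simp
  moreover have "l \<in> X"
  proof (rule closed_sequentially[OF closed_X])
    \<comment> \<open>The starting point may lie outside \<open>X\<close>, so the first term is dropped.\<close>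
    show "(\<lambda>k. x (r (Suc k)) \<omega>) \<longlonglongrightarrow> l"
      using LIMSEQ_Suc[OF lim] by (simp add: o_def)
    fix k
    have "r (Suc k) > 0"
      using seq_suble[OF r, of "Suc k"] by simp
    then show "x (r (Suc k)) \<omega> \<in> X"
      using x_Suc_in_X[OF \<omega>] by (metis gr0_implies_Suc)
  qed
  ultimately show ?thesis
    using f_min_le by (intro optimal_setI) simp_all
qed

theorem AE_convergent: "AE \<omega> in M. \<exists>l\<in>minimisers. (\<lambda>k. x k \<omega>) \<longlonglongrightarrow> l"
  using AE_summable_v2 AE_space
proof eventually_elim
  fix \<omega> assume "summable (\<lambda>k. (v k \<omega>)\<^sup>2)" and "\<omega> \<in> space M"
  then show "\<exists>l\<in>minimisers. (\<lambda>k. x k \<omega>) \<longlonglongrightarrow> l"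
    using minimisers_nonempty step_dist_le cluster_point_minimiser
    by (intro quasi_fejer_convergent[where e = "\<lambda>k. (v k \<omega>)\<^sup>2"]) auto
qed

end

theorem theorem3p8:
  fixes X :: "(real ^ 'n) set" and m :: nat and f :: "nat \<Rightarrow> real ^ 'n \<Rightarrow> real"
    and p :: real and L :: "nat \<Rightarrow> real"
    and \<gamma> :: "nat \<Rightarrow> real" and \<gamma>_lo \<gamma>_hi :: real
    and M :: "'w measure" and x0 :: "real ^ 'n"
    and v :: "nat \<Rightarrow> 'w \<Rightarrow> real" and x g :: "nat \<Rightarrow> 'w \<Rightarrow> real ^ 'n" and idx :: "nat \<Rightarrow> 'w \<Rightarrow> nat"
  assumes "X \<noteq> {}" and "closed X" and "convex X" and "m \<ge> 1"
    and "\<And>i. i \<in> {1..m} \<Longrightarrow> continuous_on UNIV (f i)"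
    and "\<And>i. i \<in> {1..m} \<Longrightarrow> quasi_convex (f i)"
    and "common_optimal X m f"
    and "p > 0" and "\<And>i. i \<in> {1..m} \<Longrightarrow> L i > 0"
    and "\<And>i. i \<in> {1..m} \<Longrightarrow> holder_condition X p (L i) (f i)"
    and "0 < \<gamma>_lo" and "\<And>k. \<gamma>_lo \<le> \<gamma> k" and "\<And>k. \<gamma> k \<le> \<gamma>_hi" and "\<gamma>_hi < 2"
    and "prob_space M"
    and "x0 \<in> X \<or> objective m f x0 > optimal_value X (objective m f)"
    and "incremental_subgradient_run X m f M x0 v x idx g"
    and "\<And>k \<omega>. \<omega> \<in> space M \<Longrightarrow>
           v k \<omega> = \<gamma> k * (R_const p m L / real m) *
             (objective m f (x k \<omega>) - optimal_value X (objective m f)) powr (1 / p)"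
  shows "AE \<omega> in M. \<exists>x_opt \<in> optimal_set X (objective m f).
           (\<lambda>k. x k \<omega>) \<longlonglongrightarrow> x_opt"
proof -
  interpret prob_space M by fact
  interpret incremental_subgradient M X m f p L \<gamma> \<gamma>_lo \<gamma>_hi x0 v x g idx
    by unfold_locales (use assms in auto)
  show ?thesis
    by (rule AE_convergent)
qed

end
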